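(* Let $X$ be a two-sided quaternionic Banach space and let $T\in\mathcal{B}_R(X)$. For $q\in\mathbb{H}$ let $\Delta_q:X\to X$, $\Delta_qx=xq-Tx$. Then (i) $\sigma_{S}(T)=\{q\in\mathbb{H}: \Delta_q\text{ is not bijective}\}$; (ii) $\sigma_{pS}(T)=\{q\in\mathbb{H}: \mathcal{N}(\Delta_q)\neq\{0\}\}$; (iii) $\sigma_{rS}(T)= \{q \in\mathbb{H} : \mathcal{N}(\Delta_q)=\{0\}\text{ and }\overline{\mathcal{R}(\Delta_q)}\neq X\}$; (iv) $\sigma_{cS}(T)= \{q \in\mathbb{H} : \mathcal{N}(\Delta_q)=\{0\},\ \overline{\mathcal{R}(\Delta_q)}= X\text{ and }\mathcal{R}(\Delta_q)\neq X\}$; (v) $\sigma_{aS}(T)= \{q \in\mathbb{H} : \text{there is a sequence } \{x_n\} \text{ of unit vectors in } X \text{ such that } \Vert \Delta_qx_n\Vert\rightarrow0\}$; (vi) $\sigma_{sS}(T)= \{q \in\mathbb{H} : \mathcal{R}(\Delta_q)\neq X\}$.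
   Context: $\mathbb{H}$ denotes the quaternions. A two-sided quaternionic Banach space $X$ is an abelian group which is both a left and a right $\mathbb{H}$-vector space, with $rx=xr$ for $r\in\mathbb{R}$ and $(px)q=p(xq)$ for $p,q\in\mathbb{H}$, complete for a norm with $\|qx\|=\|xq\|=|q|\,\|x\|$. $\mathcal{B}_R(X)$ is the set of bounded right $\mathbb{H}$-linear operators $T:X\to X$ (additive, $T(xq)=(Tx)q$). $\mathcal{N}(\cdot)$ and $\mathcal{R}(\cdot)$ denote null space and range. For $q\in\mathbb{H}$, $Q_q(T)=T^2-2\mathrm{Re}(q)T+|q|^2I$. Define $\sigma_S(T)=\{q: Q_q(T)\text{ is not invertible in }\mathcal{B}_R(X)\}$; $\sigma_{pS}(T)=\{q:\mathcal{N}(Q_q(T))\neq\{0\}\}$; $\sigma_{rS}(T)=\{q:\mathcal{N}(Q_q(T))=\{0\}\text{ and }\overline{\mathcal{R}(Q_q(T))}\neq X\}$; $\sigma_{cS}(T)=\{q:\mathcal{N}(Q_q(T))=\{0\},\ \overline{\mathcal{R}(Q_q(T))}=X\text{ and }\mathcal{R}(Q_q(T))\neq X\}$; $\sigma_{aS}(T)=\{q:\text{there are unit vectors }x_n\in X\text{ with }\|Q_q(T)x_n\|\to0\}$; $\sigma_{sS}(T)=\{q:\mathcal{R}(Q_q(T))\neq X\}$. *)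

theory Defs
  imports "HOL-Analysis.Analysis"
begin

section \<open>The quaternions\<close>

text \<open>The distribution has no type of quaternions. \<open>Quat a b c d\<close> stands for
  \<open>a + b i + c j + d k\<close>.\<close>

datatype quat = Quat (qRe: real) (qIm1: real) (qIm2: real) (qIm3: real)

lemma quat_eqI:
  "\<lbrakk>qRe p = qRe q; qIm1 p = qIm1 q; qIm2 p = qIm2 q; qIm3 p = qIm3 q\<rbrakk> \<Longrightarrow> p = q"
  by (rule quat.expand) simp

lemma quat_eq_iff:
  "p = q \<longleftrightarrow> qRe p = qRe q \<and> qIm1 p = qIm1 q \<and> qIm2 p = qIm2 q \<and> qIm3 p = qIm3 q"
  by (auto intro: quat_eqI)

instantiation quat :: real_vector
begin

definition "0 = Quat 0 0 0 0"
definition "p + q = Quat (qRe p + qRe q) (qIm1 p + qIm1 q) (qIm2 p + qIm2 q) (qIm3 p + qIm3 q)"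
definition "p - q = Quat (qRe p - qRe q) (qIm1 p - qIm1 q) (qIm2 p - qIm2 q) (qIm3 p - qIm3 q)"
definition "- q = Quat (- qRe q) (- qIm1 q) (- qIm2 q) (- qIm3 q)"
definition "r *\<^sub>R q = Quat (r * qRe q) (r * qIm1 q) (r * qIm2 q) (r * qIm3 q)"

instance
  by standard
    (simp_all add: quat_eq_iff zero_quat_def plus_quat_def minus_quat_def uminus_quat_def
      scaleR_quat_def algebra_simps)

end

instantiation quat :: real_inner
begin

definition "inner p q = qRe p * qRe q + qIm1 p * qIm1 q + qIm2 p * qIm2 q + qIm3 p * qIm3 q"
definition "norm q = sqrt ((qRe q)\<^sup>2 + (qIm1 q)\<^sup>2 + (qIm2 q)\<^sup>2 + (qIm3 q)\<^sup>2)"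
definition "sgn (q :: quat) = q /\<^sub>R norm q"
definition "dist (p :: quat) q = norm (p - q)"
definition [code del]:
  "(uniformity :: (quat \<times> quat) filter) = (INF e\<in>{0<..}. principal {(p, q). dist p q < e})"
definition [code del]:
  "open (U :: quat set) \<longleftrightarrow> (\<forall>p\<in>U. eventually (\<lambda>(p', q). p' = p \<longrightarrow> q \<in> U) uniformity)"

instance
proof
  fix p q s :: quat and r :: real
  have sos: "a\<^sup>2 + b\<^sup>2 + c\<^sup>2 + d\<^sup>2 = 0 \<longleftrightarrow> a = 0 \<and> b = 0 \<and> c = 0 \<and> d = 0"
    for a b c d :: real
    by (smt (verit) power2_eq_square zero_le_power2 zero_eq_power2)
  show "inner p q = inner q p"
    by (simp add: inner_quat_def mult.commute)
  show "inner (p + q) s = inner p s + inner q s"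
    by (simp add: inner_quat_def plus_quat_def algebra_simps)
  show "inner (r *\<^sub>R p) q = r * inner p q"
    by (simp add: inner_quat_def scaleR_quat_def algebra_simps)
  show "0 \<le> inner p p"
    by (simp add: inner_quat_def)
  show "inner p p = 0 \<longleftrightarrow> p = 0"
    using sos[of "qRe p" "qIm1 p" "qIm2 p" "qIm3 p"]
    by (simp add: inner_quat_def power2_eq_square quat_eq_iff zero_quat_def)
  show "norm p = sqrt (inner p p)"
    by (simp add: inner_quat_def norm_quat_def power2_eq_square)
qed (simp_all only: sgn_quat_def dist_quat_def uniformity_quat_def open_quat_def)

end

instantiation quat :: real_normed_div_algebra
begin

definition "1 = Quat 1 0 0 0"

text \<open>The bilinear product determined by \<open>i\<^sup>2 = j\<^sup>2 = k\<^sup>2 = i j k = -1\<close>.\<close>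

definition "p * q = Quat
  (qRe p * qRe q - qIm1 p * qIm1 q - qIm2 p * qIm2 q - qIm3 p * qIm3 q)
  (qRe p * qIm1 q + qIm1 p * qRe q + qIm2 p * qIm3 q - qIm3 p * qIm2 q)
  (qRe p * qIm2 q - qIm1 p * qIm3 q + qIm2 p * qRe q + qIm3 p * qIm1 q)
  (qRe p * qIm3 q + qIm1 p * qIm2 q - qIm2 p * qIm1 q + qIm3 p * qRe q)"

definition "inverse q = Quat (qRe q) (- qIm1 q) (- qIm2 q) (- qIm3 q) /\<^sub>R (norm q)\<^sup>2"
definition "p div q = p * inverse (q :: quat)"

instance
proof
  fix p q s :: quat and r :: real
  note defs = quat_eq_iff zero_quat_def one_quat_def plus_quat_def times_quat_def scaleR_quat_def
  show "p * q * s = p * (q * s)" "(p + q) * s = p * s + q * s" "p * (q + s) = p * q + p * s"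
    "1 * p = p" "p * 1 = p" "r *\<^sub>R p * q = r *\<^sub>R (p * q)" "p * r *\<^sub>R q = r *\<^sub>R (p * q)"
    by (simp_all add: defs algebra_simps)
  show "(0 :: quat) \<noteq> 1"
    by (simp add: defs)
  have norm2: "(norm a)\<^sup>2 = (qRe a)\<^sup>2 + (qIm1 a)\<^sup>2 + (qIm2 a)\<^sup>2 + (qIm3 a)\<^sup>2" for a :: quat
    by (simp add: norm_quat_def)
  have "(norm (p * q))\<^sup>2 = (norm p * norm q)\<^sup>2"
    unfolding power_mult_distrib norm2 times_quat_def quat.sel by algebra
  then show "norm (p * q) = norm p * norm q"
    by (simp add: power2_eq_iff_nonneg)
  show "inverse p * p = 1" "p * inverse p = 1" if "p \<noteq> 0"
  proof -
    define n where "n = (norm p)\<^sup>2"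
    have n: "n \<noteq> 0" and n': "n = (qRe p)\<^sup>2 + (qIm1 p)\<^sup>2 + (qIm2 p)\<^sup>2 + (qIm3 p)\<^sup>2"
      using that norm2[of p] by (auto simp: n_def)
    show "inverse p * p = 1" "p * inverse p = 1"
      unfolding inverse_quat_def n_def[symmetric] using n
      by (auto simp: defs field_simps) (simp_all add: n' power2_eq_square)
  qed
  show "p div q = p * inverse q"
    by (rule divide_quat_def)
  show "inverse (0 :: quat) = 0"
    by (simp add: inverse_quat_def defs)
qed

end


section \<open>Two-sided quaternionic Banach spaces\<close>

text \<open>The underlying real Banach space structure is the one carried by the class \<^class>\<open>banach\<close>.
  The condition \<open>r x = x r\<close> for real \<open>r\<close> is expressed by requiring that both quaternionic
  multiplications restrict to \<^const>\<open>scaleR\<close> on the real quaternions \<open>of_real r\<close>.\<close>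

class two_sided_quat_banach = banach +
  fixes lscale :: "quat \<Rightarrow> 'a \<Rightarrow> 'a"  (infixr "\<cdot>\<^sub>l" 75)
    and rscale :: "'a \<Rightarrow> quat \<Rightarrow> 'a"  (infixl "\<cdot>\<^sub>r" 75)
  assumes lscale_add_right: "p \<cdot>\<^sub>l (x + y) = p \<cdot>\<^sub>l x + p \<cdot>\<^sub>l y"
    and lscale_add_left: "(p + q) \<cdot>\<^sub>l x = p \<cdot>\<^sub>l x + q \<cdot>\<^sub>l x"
    and lscale_lscale: "p \<cdot>\<^sub>l (q \<cdot>\<^sub>l x) = (p * q) \<cdot>\<^sub>l x"
    and lscale_one: "1 \<cdot>\<^sub>l x = x"
    and rscale_add_left: "(x + y) \<cdot>\<^sub>r q = x \<cdot>\<^sub>r q + y \<cdot>\<^sub>r q"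
    and rscale_add_right: "x \<cdot>\<^sub>r (p + q) = x \<cdot>\<^sub>r p + x \<cdot>\<^sub>r q"
    and rscale_rscale: "(x \<cdot>\<^sub>r p) \<cdot>\<^sub>r q = x \<cdot>\<^sub>r (p * q)"
    and rscale_one: "x \<cdot>\<^sub>r 1 = x"
    and lscale_of_real: "of_real r \<cdot>\<^sub>l x = r *\<^sub>R x"
    and rscale_of_real: "x \<cdot>\<^sub>r of_real r = r *\<^sub>R x"
    and lscale_rscale: "(p \<cdot>\<^sub>l x) \<cdot>\<^sub>r q = p \<cdot>\<^sub>l (x \<cdot>\<^sub>r q)"
    and norm_lscale: "norm (q \<cdot>\<^sub>l x) = norm q * norm x"
    and norm_rscale: "norm (x \<cdot>\<^sub>r q) = norm q * norm x"


section \<open>Bounded right linear operators\<close>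

definition B_R :: "('a::two_sided_quat_banach \<Rightarrow> 'a) set" where
  "B_R = {T. (\<forall>x y. T (x + y) = T x + T y) \<and> (\<forall>x q. T (x \<cdot>\<^sub>r q) = T x \<cdot>\<^sub>r q) \<and>
             (\<exists>K. \<forall>x. norm (T x) \<le> K * norm x)}"

definition invertible_in_B_R :: "('a::two_sided_quat_banach \<Rightarrow> 'a) \<Rightarrow> bool" where
  "invertible_in_B_R A \<longleftrightarrow> A \<in> B_R \<and> (\<exists>S\<in>B_R. S \<circ> A = id \<and> A \<circ> S = id)"

definition null_space :: "('a::real_normed_vector \<Rightarrow> 'a) \<Rightarrow> 'a set" where
  "null_space f = {x. f x = 0}"

definition Q_op :: "('a::two_sided_quat_banach \<Rightarrow> 'a) \<Rightarrow> quat \<Rightarrow> 'a \<Rightarrow> 'a" where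
  "Q_op T q = (\<lambda>x. T (T x) - (2 * qRe q) *\<^sub>R T x + (norm q)\<^sup>2 *\<^sub>R x)"

lemma Q_op_in_B_R:
  assumes "T \<in> B_R"
  shows "Q_op T q \<in> B_R"
proof -
  have add: "T (x + y) = T x + T y" and hom: "T (x \<cdot>\<^sub>r p) = T x \<cdot>\<^sub>r p" for x y p
    using assms by (auto simp: B_R_def)
  obtain K where K: "norm (T x) \<le> K * norm x" for x
    using assms by (auto simp: B_R_def)
  have K': "norm (T x) \<le> \<bar>K\<bar> * norm x" for x
    using K[of x] mult_right_mono[OF abs_ge_self[of K] norm_ge_zero[of x]] by linarith
  have rscale_scaleR: "(r *\<^sub>R x) \<cdot>\<^sub>r p = r *\<^sub>R (x \<cdot>\<^sub>r p)" for r p and x :: 'a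
    by (metis lscale_of_real lscale_rscale)
  have rscale_diff: "(x - y) \<cdot>\<^sub>r p = x \<cdot>\<^sub>r p - y \<cdot>\<^sub>r p" for p and x y :: 'a
    by (metis add_diff_cancel diff_add_cancel rscale_add_left)
  have "norm (Q_op T q x) \<le> (\<bar>K\<bar> * \<bar>K\<bar> + \<bar>2 * qRe q\<bar> * \<bar>K\<bar> + (norm q)\<^sup>2) * norm x" for x
  proof -
    have "norm (Q_op T q x) \<le>
        norm (T (T x)) + norm ((2 * qRe q) *\<^sub>R T x) + norm ((norm q)\<^sup>2 *\<^sub>R x)"
      unfolding Q_op_def by (intro norm_triangle_le add_mono norm_triangle_ineq4 order_refl)
    also have "\<dots> = norm (T (T x)) + \<bar>2 * qRe q\<bar> * norm (T x) + (norm q)\<^sup>2 * norm x"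
      by simp
    also have "\<dots> \<le> \<bar>K\<bar> * (\<bar>K\<bar> * norm x) + \<bar>2 * qRe q\<bar> * (\<bar>K\<bar> * norm x) + (norm q)\<^sup>2 * norm x"
      by (intro add_mono mult_left_mono K' order_refl order_trans[OF K'[of "T x"]]) simp_all
    finally show ?thesis
      by (simp add: algebra_simps)
  qed
  moreover have "Q_op T q (x + y) = Q_op T q x + Q_op T q y" for x y
    by (simp add: Q_op_def add scaleR_add_right)
  moreover have "Q_op T q (x \<cdot>\<^sub>r p) = Q_op T q x \<cdot>\<^sub>r p" for x p
    by (simp add: Q_op_def hom rscale_add_left rscale_diff rscale_scaleR)
  ultimately show ?thesis
    unfolding B_R_def by blast
qed

text \<open>\<open>Delta T q\<close> is in general only real linear, hence not a member of \<^const>\<open>B_R\<close>.\<close>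

definition Delta :: "('a::two_sided_quat_banach \<Rightarrow> 'a) \<Rightarrow> quat \<Rightarrow> 'a \<Rightarrow> 'a" where
  "Delta T q = (\<lambda>x. x \<cdot>\<^sub>r q - T x)"


section \<open>The S-spectrum and its parts\<close>

definition sigma_S :: "('a::two_sided_quat_banach \<Rightarrow> 'a) \<Rightarrow> quat set" where
  "sigma_S T = {q. \<not> invertible_in_B_R (Q_op T q)}"

definition sigma_pS :: "('a::two_sided_quat_banach \<Rightarrow> 'a) \<Rightarrow> quat set" where
  "sigma_pS T = {q. null_space (Q_op T q) \<noteq> {0}}"

definition sigma_rS :: "('a::two_sided_quat_banach \<Rightarrow> 'a) \<Rightarrow> quat set" where
  "sigma_rS T = {q. null_space (Q_op T q) = {0} \<and> closure (range (Q_op T q)) \<noteq> UNIV}"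

definition sigma_cS :: "('a::two_sided_quat_banach \<Rightarrow> 'a) \<Rightarrow> quat set" where
  "sigma_cS T = {q. null_space (Q_op T q) = {0} \<and> closure (range (Q_op T q)) = UNIV \<and>
                    range (Q_op T q) \<noteq> UNIV}"

definition sigma_aS :: "('a::two_sided_quat_banach \<Rightarrow> 'a) \<Rightarrow> quat set" where
  "sigma_aS T = {q. \<exists>x :: nat \<Rightarrow> 'a. (\<forall>n. norm (x n) = 1) \<and>
                    (\<lambda>n. norm (Q_op T q (x n))) \<longlonglongrightarrow> 0}"

definition sigma_sS :: "('a::two_sided_quat_banach \<Rightarrow> 'a) \<Rightarrow> quat set" where
  "sigma_sS T = {q. range (Q_op T q) \<noteq> UNIV}"

end

theory Submission
  imports Defs
begin

text \<open>Write \<open>q'\<close> for the conjugate of \<open>q\<close>. Since \<open>q + q'\<close> and \<open>q q'\<close> are real, \<open>Q\<^sub>q(T)\<close> is the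
  product, in either order, of \<open>\<Delta>\<^sub>q\<close> and \<open>\<Delta>\<^bsub>q'\<^esub>\<close>. Moreover \<open>p q' = q p\<close> for some \<open>p \<noteq> 0\<close>, so the
  homeomorphism \<open>x \<mapsto> x p\<close> conjugates the two factors into each other. Hence injectivity,
  surjectivity, density of the range and boundedness from below hold for both factors or for
  neither, and therefore for \<open>Q\<^sub>q(T)\<close> exactly when they hold for \<open>\<Delta>\<^sub>q\<close>. For (i) the open mapping
  theorem makes a bijective \<open>Q\<^sub>q(T)\<close> invertible among the bounded operators.\<close>

section \<open>The open mapping theorem\<close>

lemma surj_bounded_linear_approx_preimage:
  fixes f :: "'a::real_normed_vector \<Rightarrow> 'b::banach"
  assumes f: "bounded_linear f" and "surj f"
  obtains K where "K > 0" and "\<And>y e. e > 0 \<Longrightarrow> \<exists>x. norm x \<le> K * norm y \<and> norm (y - f x) < e"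
proof -
  interpret bounded_linear f by (rule f)
  define C where "C n = closure (f ` cball 0 (real n))" for n
  have "y \<in> (\<Union>n. C n)" for y
  proof -
    obtain x where "y = f x"
      using \<open>surj f\<close> by blast
    moreover obtain n where "norm x \<le> real n"
      using real_arch_simple by blast
    ultimately have "y \<in> C n"
      unfolding C_def using closure_subset by fastforce
    then show ?thesis by blast
  qed
  then have "\<Union>(range C) = UNIV"
    by blast
  then have "interior (\<Union>(range C)) \<noteq> {}"
    by simp
  moreover have "interior (\<Union>(range C)) = {}" if "\<And>n. interior (C n) = {}"
  proof -
    have "euclidean interior_of \<Union>(range C) = {}"
      by (rule Baire_category_alt)
        (use that in \<open>auto simp: completely_metrizable_space_euclidean C_def simp flip: closed_closedin\<close>)
    then show ?thesis by simp
  qed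
  ultimately obtain n y0 where "y0 \<in> interior (C n)"
    by blast
  then obtain r where "r > 0" and r: "ball y0 r \<subseteq> C n"
    by (meson mem_interior)
  have near: "\<exists>x. norm x \<le> 2 * real n \<and> norm (z - f x) < e" if "norm z < r" "e > 0" for z e
  proof -
    have "y0 \<in> C n" "y0 + z \<in> C n"
      using r \<open>r > 0\<close> that by (auto simp: subset_iff dist_norm)
    moreover have "\<exists>a. norm a \<le> real n \<and> dist (f a) w < e / 2" if "w \<in> C n" for w
    proof -
      obtain v where "v \<in> f ` cball 0 (real n)" "dist v w < e / 2"
        using \<open>w \<in> C n\<close> half_gt_zero[OF \<open>e > 0\<close>] unfolding C_def closure_approachable by blast
      then show ?thesis by auto
    qed
    ultimately obtain a b where a: "norm a \<le> real n" "dist (f a) (y0 + z) < e / 2"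
      and b: "norm b \<le> real n" "dist (f b) y0 < e / 2"
      by blast
    have "norm (z - f (a - b)) = norm ((f b - y0) - (f a - (y0 + z)))"
      by (simp add: diff algebra_simps)
    also have "\<dots> < e"
      using norm_triangle_ineq4[of "f b - y0" "f a - (y0 + z)"] a b by (simp add: dist_norm)
    finally have "norm (z - f (a - b)) < e" .
    moreover have "norm (a - b) \<le> 2 * real n"
      using norm_triangle_ineq4[of a b] a b by simp
    ultimately show ?thesis by blast
  qed
  show ?thesis
  proof
    show "4 * (real n + 1) / r > 0"
      using \<open>r > 0\<close> by simp
    fix y :: 'b and e :: real
    assume "e > 0"
    show "\<exists>x. norm x \<le> 4 * (real n + 1) / r * norm y \<and> norm (y - f x) < e"
    proof (cases "y = 0")
      case True
      then show ?thesis
        using \<open>e > 0\<close> by (intro exI[of _ 0]) (simp add: zero)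
    next
      case False
      define s where "s = r / (2 * norm y)"
      have "s > 0" and s: "s * norm y = r / 2"
        using \<open>r > 0\<close> False by (auto simp: s_def)
      obtain x where x: "norm x \<le> 2 * real n" "norm (s *\<^sub>R y - f x) < s * e"
        using near[of "s *\<^sub>R y" "s * e"] \<open>s > 0\<close> \<open>r > 0\<close> \<open>e > 0\<close> s by auto
      have "y - f (x /\<^sub>R s) = (s *\<^sub>R y - f x) /\<^sub>R s"
        using \<open>s > 0\<close> by (simp add: scaleR scaleR_diff_right)
      then have "norm (y - f (x /\<^sub>R s)) = norm (s *\<^sub>R y - f x) / s"
        using \<open>s > 0\<close> by (simp add: divide_inverse_commute)
      also have "\<dots> < e"
        using x \<open>s > 0\<close> by (simp add: pos_divide_less_eq mult.commute)
      finally have "norm (y - f (x /\<^sub>R s)) < e" .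
      moreover have "norm (x /\<^sub>R s) \<le> 4 * (real n + 1) / r * norm y"
      proof -
        have "norm (x /\<^sub>R s) = norm x * (2 * norm y / r)"
          using \<open>r > 0\<close> False by (simp add: s_def)
        also have "\<dots> \<le> (2 * (real n + 1)) * (2 * norm y / r)"
          using x \<open>r > 0\<close> by (intro mult_right_mono) auto
        finally show ?thesis by (simp add: field_simps)
      qed
      ultimately show ?thesis by blast
    qed
  qed
qed

lemma surj_bounded_linear_bounded_preimage:
  fixes f :: "'a::banach \<Rightarrow> 'b::banach"
  assumes f: "bounded_linear f" and "surj f"
  obtains K where "\<And>y. \<exists>x. f x = y \<and> norm x \<le> K * norm y"
proof -
  interpret bounded_linear f by (rule f)
  obtain K where "K > 0"
    and K: "\<And>y e. e > 0 \<Longrightarrow> \<exists>x. norm x \<le> K * norm y \<and> norm (y - f x) < e"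
    using surj_bounded_linear_approx_preimage[OF assms] by metis
  have "\<exists>x. norm x \<le> K * norm y \<and> norm (y - f x) \<le> norm y / 2" for y
  proof (cases "y = 0")
    case True
    then show ?thesis
      by (intro exI[of _ 0]) (simp add: zero)
  next
    case False
    then show ?thesis
      using K[of "norm y / 2" y] by force
  qed
  then obtain g where g: "norm (g y) \<le> K * norm y" "norm (y - f (g y)) \<le> norm y / 2" for y
    by metis
  have "\<exists>x. f x = y \<and> norm x \<le> (2 * K) * norm y" for y
  proof -
    define z where "z n = ((\<lambda>y. y - f (g y)) ^^ n) y" for n
    have z0: "z 0 = y" and zSuc: "z (Suc n) = z n - f (g (z n))" for n
      by (simp_all add: z_def)
    have z: "norm (z n) \<le> norm y * (1 / 2) ^ n" for n
    proof (induction n)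
      case (Suc n)
      then show ?case
        using g(2)[of "z n"] by (simp add: zSuc)
    qed (simp add: z0)
    have gz: "norm (g (z n)) \<le> K * norm y * (1 / 2) ^ n" for n
      using order_trans[OF g(1) mult_left_mono[OF z]] \<open>K > 0\<close> by (simp add: mult.assoc)
    have geo: "(\<lambda>n. K * norm y * (1 / 2) ^ n) sums (K * norm y * 2)"
      using sums_mult[OF geometric_sums[of "1 / 2 :: real"]] by simp
    have summable_norm_gz: "summable (\<lambda>n. norm (g (z n)))"
      using summable_comparison_test'[OF sums_summable[OF geo], of 0 "\<lambda>n. norm (g (z n))"] gz by simp
    have "z \<longlonglongrightarrow> 0"
    proof (rule Lim_null_comparison)
      show "\<forall>\<^sub>F n in sequentially. norm (z n) \<le> norm y * (1 / 2) ^ n"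
        using z by simp
      show "(\<lambda>n. norm y * (1 / 2) ^ n) \<longlonglongrightarrow> 0"
        by (intro tendsto_mult_right_zero LIMSEQ_power_zero) simp
    qed
    from telescope_sums'[OF this] have "(\<lambda>n. f (g (z n))) sums y"
      by (simp add: zSuc z0)
    moreover have "(\<lambda>n. f (g (z n))) sums f (\<Sum>n. g (z n))"
      by (rule sums[OF summable_sums[OF summable_norm_cancel[OF summable_norm_gz]]])
    ultimately have "f (\<Sum>n. g (z n)) = y"
      by (rule sums_unique2[symmetric])
    moreover have "norm (\<Sum>n. g (z n)) \<le> K * norm y * 2"
      using order_trans[OF summable_norm[OF summable_norm_gz]
          suminf_le[OF gz summable_norm_gz sums_summable[OF geo]]]
      by (simp only: sums_unique[OF geo])
    ultimately show ?thesis
      by (intro exI[of _ "\<Sum>n. g (z n)"]) (simp add: mult_ac)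
  qed
  then show ?thesis by (rule that)
qed

section \<open>Linear maps\<close>

lemma null_space_eq_0_iff_inj:
  assumes "linear f"
  shows "null_space f = {0} \<longleftrightarrow> inj f"
  using linear_injective_0[OF assms] linear_0[OF assms] by (auto simp: null_space_def)

lemma closure_range_comp_UNIV:
  fixes g :: "'b::topological_space \<Rightarrow> 'c::topological_space"
  assumes "continuous_on UNIV g" "closure (range f) = UNIV" "closure (range g) = UNIV"
  shows "closure (range (g \<circ> f)) = UNIV"
proof -
  have "g ` closure (range f) \<subseteq> closure (g ` range f)"
    using assms by (intro image_closure_subset) (auto intro: closure_subset[THEN subsetD])
  then have "range g \<subseteq> closure (range (g \<circ> f))"
    by (simp add: assms image_comp)
  then show ?thesis
    using closure_minimal[of "range g"] assms(3) by auto
qed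

definition bounded_below_map :: "('a::real_normed_vector \<Rightarrow> 'b::real_normed_vector) \<Rightarrow> bool" where
  "bounded_below_map f \<longleftrightarrow> (\<exists>c>0. \<forall>x. c * norm x \<le> norm (f x))"

lemma bounded_below_map_comp:
  assumes "bounded_below_map g" "bounded_below_map f"
  shows "bounded_below_map (g \<circ> f)"
proof -
  obtain c d where "c > 0" "d > 0" and c: "\<And>x. c * norm x \<le> norm (g x)"
    and d: "\<And>x. d * norm x \<le> norm (f x)"
    using assms by (auto simp: bounded_below_map_def)
  have "(c * d) * norm x \<le> norm ((g \<circ> f) x)" for x
    using order_trans[OF mult_left_mono[OF d[of x], of c] c[of "f x"]] \<open>c > 0\<close>
    by (simp add: mult.assoc)
  then show ?thesis
    using \<open>c > 0\<close> \<open>d > 0\<close> unfolding bounded_below_map_def by (meson mult_pos_pos)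
qed

lemma bounded_below_map_of_comp:
  assumes "bounded_linear g" "bounded_below_map (g \<circ> f)"
  shows "bounded_below_map f"
proof -
  obtain c where "c > 0" and c: "\<And>x. c * norm x \<le> norm (g (f x))"
    using assms by (auto simp: bounded_below_map_def)
  obtain K where "K > 0" and K: "\<And>x. norm (g x) \<le> norm x * K"
    using bounded_linear.pos_bounded[OF assms(1)] by blast
  have "c / K * norm x \<le> norm (f x)" for x
    using order_trans[OF c K, of x] \<open>K > 0\<close> by (simp add: field_simps)
  then show ?thesis
    using \<open>c > 0\<close> \<open>K > 0\<close> unfolding bounded_below_map_def by (meson divide_pos_pos)
qed

lemma unit_vectors_tendsto_0_iff_not_bounded_below_map:
  assumes "linear f"
  shows "(\<exists>x :: nat \<Rightarrow> _. (\<forall>n. norm (x n) = 1) \<and> (\<lambda>n. norm (f (x n))) \<longlonglongrightarrow> 0) \<longleftrightarrow>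
    \<not> bounded_below_map f"
proof
  assume "\<exists>x :: nat \<Rightarrow> _. (\<forall>n. norm (x n) = 1) \<and> (\<lambda>n. norm (f (x n))) \<longlonglongrightarrow> 0"
  then obtain x :: "nat \<Rightarrow> _" where x: "\<And>n. norm (x n) = 1" "(\<lambda>n. norm (f (x n))) \<longlonglongrightarrow> 0"
    by blast
  show "\<not> bounded_below_map f"
  proof
    assume "bounded_below_map f"
    then obtain c where "c > 0" "\<And>x. c * norm x \<le> norm (f x)"
      by (auto simp: bounded_below_map_def)
    then have "c \<le> norm (f (x n))" for n
      using x(1) by (metis mult.right_neutral)
    then show False
      using LIMSEQ_le_const[OF x(2), of c] \<open>c > 0\<close> by force
  qed
next
  assume nb: "\<not> bounded_below_map f"
  have "\<exists>x. norm x = 1 \<and> norm (f x) < inverse (real (Suc n))" for n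
  proof -
    have "\<not> (\<forall>x. inverse (real (Suc n)) * norm x \<le> norm (f x))"
      using nb unfolding bounded_below_map_def
      by (metis inverse_positive_iff_positive of_nat_0_less_iff zero_less_Suc)
    then obtain x where x: "norm (f x) < inverse (real (Suc n)) * norm x"
      by (auto simp: not_le)
    then have "x \<noteq> 0"
      using linear_0[OF assms] by auto
    then have "norm (x /\<^sub>R norm x) = 1" "norm (f (x /\<^sub>R norm x)) < inverse (real (Suc n))"
      using x by (simp_all add: linear_cmul[OF assms] field_simps del: of_nat_Suc)
    then show ?thesis by blast
  qed
  then obtain x where x: "\<And>n. norm (x n) = 1" "\<And>n. norm (f (x n)) < inverse (real (Suc n))"
    by metis
  have "(\<lambda>n. norm (f (x n))) \<longlonglongrightarrow> 0"
    by (rule Lim_null_comparison[OF _ LIMSEQ_inverse_real_of_nat])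
      (use x(2) in \<open>simp add: less_imp_le del: of_nat_Suc\<close>)
  with x(1) show "\<exists>x :: nat \<Rightarrow> _. (\<forall>n. norm (x n) = 1) \<and> (\<lambda>n. norm (f (x n))) \<longlonglongrightarrow> 0"
    by blast
qed

section \<open>Conjugation of quaternions\<close>

definition quat_cnj :: "quat \<Rightarrow> quat" where
  "quat_cnj q = Quat (qRe q) (- qIm1 q) (- qIm2 q) (- qIm3 q)"

lemma quat_cnj_cnj [simp]: "quat_cnj (quat_cnj q) = q"
  by (simp add: quat_cnj_def)

lemma qRe_quat_cnj [simp]: "qRe (quat_cnj q) = qRe q"
  by (simp add: quat_cnj_def)

lemma norm_quat_cnj [simp]: "norm (quat_cnj q) = norm q"
  by (simp add: quat_cnj_def norm_quat_def)

lemma of_real_quat: "of_real r = Quat r 0 0 0"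
  by (simp add: of_real_def one_quat_def scaleR_quat_def)

lemma quat_add_cnj: "q + quat_cnj q = of_real (2 * qRe q)"
  by (simp add: of_real_quat quat_cnj_def plus_quat_def)

lemma quat_cnj_mult_self: "quat_cnj q * q = of_real ((norm q)\<^sup>2)"
  unfolding of_real_quat quat_cnj_def times_quat_def norm_quat_def
  by (simp add: power2_eq_square algebra_simps)

lemma quat_similar_cnj:
  obtains p where "p \<noteq> 0" "p * quat_cnj q = q * p"
proof
  \<comment> \<open>A purely imaginary \<open>p\<close> anticommutes with the imaginary part of \<open>q\<close> if it is orthogonal to it.\<close>
  define p where "p = (if qIm1 q = 0 \<and> qIm2 q = 0 then Quat 0 1 0 0 else Quat 0 (- qIm2 q) (qIm1 q) 0)"
  show "p \<noteq> 0"
    by (auto simp: p_def zero_quat_def)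
  show "p * quat_cnj q = q * p"
    by (auto simp: p_def quat_cnj_def times_quat_def)
qed

section \<open>Operators on a two-sided quaternionic Banach space\<close>

lemma bounded_linear_rscale: "bounded_linear (\<lambda>x :: 'a::two_sided_quat_banach. x \<cdot>\<^sub>r q)"
proof (rule bounded_linear_intro)
  fix r :: real and x y :: 'a
  show "(x + y) \<cdot>\<^sub>r q = x \<cdot>\<^sub>r q + y \<cdot>\<^sub>r q"
    by (rule rscale_add_left)
  show "(r *\<^sub>R x) \<cdot>\<^sub>r q = r *\<^sub>R (x \<cdot>\<^sub>r q)"
    by (metis lscale_of_real lscale_rscale)
  show "norm (x \<cdot>\<^sub>r q) \<le> norm x * norm q"
    by (simp add: norm_rscale mult.commute)
qed

lemma bij_rscale:
  assumes "p \<noteq> 0"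
  shows "bij (\<lambda>x :: 'a::two_sided_quat_banach. x \<cdot>\<^sub>r p)"
  by (rule o_bij[of "\<lambda>x. x \<cdot>\<^sub>r inverse p"])
    (simp_all add: fun_eq_iff rscale_rscale rscale_one assms)

lemma bounded_below_map_rscale:
  assumes "p \<noteq> 0"
  shows "bounded_below_map (\<lambda>x :: 'a::two_sided_quat_banach. x \<cdot>\<^sub>r p)"
  unfolding bounded_below_map_def norm_rscale using assms by (intro exI[of _ "norm p"]) simp

lemma B_R_imp_bounded_linear:
  assumes "T \<in> B_R"
  shows "bounded_linear T"
proof -
  obtain K where K: "\<And>x. norm (T x) \<le> K * norm x"
    using assms by (auto simp: B_R_def)
  show ?thesis
  proof (rule bounded_linear_intro)
    show "T (r *\<^sub>R x) = r *\<^sub>R T x" for r x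
      using assms by (simp add: B_R_def flip: rscale_of_real)
    show "norm (T x) \<le> norm x * K" for x
      using K by (simp add: mult.commute)
  qed (use assms in \<open>simp add: B_R_def\<close>)
qed

lemma invertible_in_B_R_iff_bij:
  assumes "A \<in> B_R"
  shows "invertible_in_B_R A \<longleftrightarrow> bij A"
proof
  assume "invertible_in_B_R A"
  then show "bij A"
    unfolding invertible_in_B_R_def by (blast intro: o_bij)
next
  assume "bij A"
  note inv = bij_is_inj[OF \<open>bij A\<close>] bij_is_surj[OF \<open>bij A\<close>]
  obtain K where K: "\<And>y. \<exists>x. A x = y \<and> norm x \<le> K * norm y"
    using surj_bounded_linear_bounded_preimage[OF B_R_imp_bounded_linear[OF assms] inv(2)] by metis
  have "inv A \<in> B_R"
    unfolding B_R_def
  proof (intro CollectI conjI allI exI)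
    show "inv A (x + y) = inv A x + inv A y" for x y
      using assms by (intro inv_f_eq inv) (simp add: B_R_def surj_f_inv_f inv)
    show "inv A (x \<cdot>\<^sub>r q) = inv A x \<cdot>\<^sub>r q" for x q
      using assms by (intro inv_f_eq inv) (simp add: B_R_def surj_f_inv_f inv)
    show "norm (inv A y) \<le> K * norm y" for y
      using K[of y] inv by auto
  qed
  then show "invertible_in_B_R A"
    unfolding invertible_in_B_R_def using assms inv by (auto simp: surj_iff inj_iff)
qed

lemma bounded_linear_Delta:
  assumes "T \<in> B_R"
  shows "bounded_linear (Delta T q)"
  unfolding Delta_def
  by (intro bounded_linear_sub bounded_linear_rscale B_R_imp_bounded_linear assms)

lemma Q_op_eq_Delta_comp:
  assumes "T \<in> B_R"
  shows "Q_op T q = Delta T q \<circ> Delta T (quat_cnj q)"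
proof
  fix x
  interpret T: bounded_linear T
    by (rule B_R_imp_bounded_linear[OF assms])
  interpret R: bounded_linear "\<lambda>x :: 'a. x \<cdot>\<^sub>r p" for p
    by (rule bounded_linear_rscale)
  have hom: "T (y \<cdot>\<^sub>r p) = T y \<cdot>\<^sub>r p" for y p
    using assms by (simp add: B_R_def)
  have "(Delta T q \<circ> Delta T (quat_cnj q)) x =
      x \<cdot>\<^sub>r (quat_cnj q * q) - T x \<cdot>\<^sub>r (q + quat_cnj q) + T (T x)"
    by (simp add: Delta_def R.diff T.diff hom rscale_rscale rscale_add_right)
  also have "\<dots> = Q_op T q x"
    unfolding quat_add_cnj quat_cnj_mult_self rscale_of_real Q_op_def by simp
  finally show "Q_op T q x = (Delta T q \<circ> Delta T (quat_cnj q)) x" ..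
qed

lemma Q_op_cnj: "Q_op T (quat_cnj q) = Q_op T q"
  by (simp add: Q_op_def)

lemma Q_op_eq_Delta_cnj_comp:
  assumes "T \<in> B_R"
  shows "Q_op T q = Delta T (quat_cnj q) \<circ> Delta T q"
  using Q_op_eq_Delta_comp[OF assms, of "quat_cnj q"] by (simp add: Q_op_cnj)

lemma Delta_cnj_rscale:
  assumes "T \<in> B_R" "p * quat_cnj q = q * p"
  shows "Delta T (quat_cnj q) \<circ> (\<lambda>x. x \<cdot>\<^sub>r p) = (\<lambda>x. x \<cdot>\<^sub>r p) \<circ> Delta T q"
  using assms
  by (simp add: fun_eq_iff Delta_def B_R_def rscale_rscale
      linear_diff[OF bounded_linear.linear[OF bounded_linear_rscale]])

lemma Q_op_transfer:
  fixes T :: "'a::two_sided_quat_banach \<Rightarrow> 'a"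
  assumes T: "T \<in> B_R"
    and comp: "\<And>f g. \<lbrakk>bounded_linear f; bounded_linear g; P f; P g\<rbrakk> \<Longrightarrow> P (f \<circ> g :: 'a \<Rightarrow> 'a)"
    and factor: "\<And>f g. \<lbrakk>bounded_linear f; bounded_linear g; f \<circ> g = g \<circ> f; P (f \<circ> g)\<rbrakk> \<Longrightarrow> P f"
    and rscale: "\<And>p. p \<noteq> 0 \<Longrightarrow> P (\<lambda>x. x \<cdot>\<^sub>r p)"
  shows "P (Q_op T q) \<longleftrightarrow> P (Delta T q)"
proof
  note D = bounded_linear_Delta[OF T]
  show "P (Delta T q)" if "P (Q_op T q)"
  proof (rule factor[OF D D])
    show "P (Delta T q \<circ> Delta T (quat_cnj q))"
      using that by (simp only: Q_op_eq_Delta_comp[OF T])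
    show "Delta T q \<circ> Delta T (quat_cnj q) = Delta T (quat_cnj q) \<circ> Delta T q"
      by (simp only: Q_op_eq_Delta_comp[OF T, symmetric] Q_op_eq_Delta_cnj_comp[OF T, symmetric])
  qed
  assume P: "P (Delta T q)"
  obtain p where "p \<noteq> 0" and p: "p * quat_cnj q = q * p"
    by (rule quat_similar_cnj)
  let ?R = "\<lambda>p x :: 'a. x \<cdot>\<^sub>r p"
  have "?R p \<circ> ?R (inverse p) = id"
    using \<open>p \<noteq> 0\<close> by (simp add: fun_eq_iff rscale_rscale rscale_one)
  then have "Delta T (quat_cnj q) = (Delta T (quat_cnj q) \<circ> ?R p) \<circ> ?R (inverse p)"
    by (simp only: comp_assoc comp_id)
  also have "\<dots> = ?R p \<circ> (Delta T q \<circ> ?R (inverse p))"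
    by (simp only: Delta_cnj_rscale[OF T p] comp_assoc)
  finally have "Delta T (quat_cnj q) = \<dots>" .
  moreover have "P (?R p \<circ> (Delta T q \<circ> ?R (inverse p)))"
  proof (intro comp bounded_linear_rscale D P rscale)
    show "bounded_linear (Delta T q \<circ> ?R (inverse p))"
      unfolding comp_def by (intro bounded_linear_compose[OF D] bounded_linear_rscale)
  qed (use \<open>p \<noteq> 0\<close> in simp_all)
  ultimately have "P (Delta T (quat_cnj q))"
    by (simp only:)
  then show "P (Q_op T q)"
    unfolding Q_op_eq_Delta_comp[OF T] using P D comp by blast
qed

lemma inj_Q_op_iff:
  assumes "T \<in> B_R"
  shows "inj (Q_op T q) \<longleftrightarrow> inj (Delta T q)"
proof (rule Q_op_transfer[OF assms])
  show "inj f" if "f \<circ> g = g \<circ> f" "inj (f \<circ> g)" for f g :: "'a \<Rightarrow> 'a"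
    using that(2) unfolding that(1) by (rule inj_on_imageI2)
qed (rule inj_compose bij_is_inj[OF bij_rscale]; assumption)+

lemma surj_Q_op_iff:
  assumes "T \<in> B_R"
  shows "surj (Q_op T q) \<longleftrightarrow> surj (Delta T q)"
proof (rule Q_op_transfer[OF assms])
  show "surj f" if "surj (f \<circ> g)" for f g :: "'a \<Rightarrow> 'a"
    using that by (auto simp: surj_def)
qed (rule comp_surj bij_is_surj[OF bij_rscale]; assumption)+

lemma dense_range_Q_op_iff:
  assumes "T \<in> B_R"
  shows "closure (range (Q_op T q)) = UNIV \<longleftrightarrow> closure (range (Delta T q)) = UNIV"
proof (rule Q_op_transfer[OF assms])
  show "closure (range f) = UNIV" if "closure (range (f \<circ> g)) = UNIV" for f g :: "'a \<Rightarrow> 'a"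
    using that closure_mono[of "range (f \<circ> g)" "range f"] by auto
  show "closure (range (\<lambda>x::'a. x \<cdot>\<^sub>r p)) = UNIV" if "p \<noteq> 0" for p
    by (simp add: bij_is_surj[OF bij_rscale[OF that]])
  show "closure (range (f \<circ> g)) = UNIV"
    if "bounded_linear f" "closure (range f) = UNIV" "closure (range g) = UNIV" for f g :: "'a \<Rightarrow> 'a"
    using that by (intro closure_range_comp_UNIV linear_continuous_on)
qed

lemma bounded_below_map_Q_op_iff:
  assumes "T \<in> B_R"
  shows "bounded_below_map (Q_op T q) \<longleftrightarrow> bounded_below_map (Delta T q)"
proof (rule Q_op_transfer[OF assms])
  show "bounded_below_map f"
    if "bounded_linear g" "f \<circ> g = g \<circ> f" "bounded_below_map (f \<circ> g)" for f g :: "'a \<Rightarrow> 'a"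
    using that by (intro bounded_below_map_of_comp[of g f]) simp_all
qed (rule bounded_below_map_comp bounded_below_map_rscale; assumption)+

theorem proposition3p4:
  fixes T :: "'a::two_sided_quat_banach \<Rightarrow> 'a"
  assumes "T \<in> B_R"
  shows "sigma_S T = {q. \<not> bij (Delta T q)} \<and>
    sigma_pS T = {q. null_space (Delta T q) \<noteq> {0}} \<and>
    sigma_rS T = {q. null_space (Delta T q) = {0} \<and> closure (range (Delta T q)) \<noteq> UNIV} \<and>
    sigma_cS T = {q. null_space (Delta T q) = {0} \<and> closure (range (Delta T q)) = UNIV \<and>
                     range (Delta T q) \<noteq> UNIV} \<and>
    sigma_aS T = {q. \<exists>x :: nat \<Rightarrow> 'a. (\<forall>n. norm (x n) = 1) \<and>
                     (\<lambda>n. norm (Delta T q (x n))) \<longlonglongrightarrow> 0} \<and>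
    sigma_sS T = {q. range (Delta T q) \<noteq> UNIV}"
proof -
  have "linear (Delta T q)" "linear (Q_op T q)" for q
    using bounded_linear_Delta[OF assms] B_R_imp_bounded_linear[OF Q_op_in_B_R[OF assms]]
    by (simp_all add: bounded_linear.linear)
  note lin = this[THEN null_space_eq_0_iff_inj]
    this[THEN unit_vectors_tendsto_0_iff_not_bounded_below_map]
  show ?thesis
    unfolding sigma_S_def sigma_pS_def sigma_rS_def sigma_cS_def sigma_aS_def sigma_sS_def
      lin invertible_in_B_R_iff_bij[OF Q_op_in_B_R[OF assms]]
      bij_def inj_Q_op_iff[OF assms] surj_Q_op_iff[OF assms] dense_range_Q_op_iff[OF assms]
      bounded_below_map_Q_op_iff[OF assms]
    by simp
qed

end
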